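(* Fix a system of fundamental sequences on an ordinal $\Gamma$ and an infinite set $M\subseteq\mathbb{N}$ with $\min M>1$. For $\alpha\le\Gamma$ let $\mathcal{B}^\alpha$ be the set of $\alpha$-size finite subsets of $M$. Then for each $\alpha\le\Gamma$, $\mathcal{B}^\alpha$ is a front. Moreover, if the system is nested, every $\mathcal{B}^\alpha$ is a smooth barrier.
   Context: A fundamental sequence for an ordinal $\alpha>0$ is a non-decreasing sequence $(\alpha[n])_{n\in\omega}$ with $\sup_n(\alpha[n]+1)=\alpha$; $0[n]=0$. A system on $\Gamma$ fixes one for each $\alpha\le\Gamma$; it is nested if there are never $\gamma<\beta\le\Gamma$ and $n>1$ with $\gamma>\beta[n]>\gamma[n]$. Finite subsets of $\mathbb{N}$ are identified with strictly increasing sequences; for $s=\langle s_0,\dots,s_{m-1}\rangle$, $\alpha[s]=\alpha[s_0][s_1]\cdots[s_{m-1}]$ ($\alpha[\langle\rangle]=\alpha$), and $s^*=s\setminus\{\max s\}$. $s$ is $\alpha$-size if $\alpha[s]=0$ and, when $s\ne\langle\rangle$, $\alpha[s^*]>0$. $s\sqsubseteq t$: initial segment; $\sqsubset$: proper. A set $\mathcal{B}\subseteq[\mathbb{N}]^{<\omega}$ is a front if either $\mathcal{B}=\{\langle\rangle\}$ or: (1) $\operatorname{base}(\mathcal{B})=\bigcup_{s\in\mathcal{B}}s$ is infinite; (2) every infinite $X\subseteq\operatorname{base}(\mathcal{B})$ has $s\in\mathcal{B}$ with $s\sqsubset X$; (3) no $s,t\in\mathcal{B}$ with $s\sqsubset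 t$. A barrier is a front with no $s,t\in\mathcal{B}$, $s\subsetneq t$. A front is smooth if for all $s,t\in\mathcal{B}$ with $|s|<|t|$ there is $i<|s|$ with $s(i)<t(i)$. *)

theory Defs
  imports
    "HOL-Library.Infinite_Set"
    "HOL-Library.Lub_Glb"
    "HOL-Library.Sublist"
begin

text \<open>
  Ordinals are the elements of an arbitrary well-ordered type without a largest element: an element
  plays the role of the order type of the set of its predecessors, \<open>\<bottom>\<close> is the ordinal 0, and
  every ordinal \<open>\<Gamma>\<close> occurs as an element of such a type (for instance one of order type
  \<open>\<Gamma> + \<omega>\<close>).  The absence of a largest element makes the successor below a genuine successor.
\<close>

unbundle lattice_syntax

definition ord_suc :: "'a::{wellorder,no_top} \<Rightarrow> 'a" where
  "ord_suc \<alpha> = (LEAST \<beta>. \<alpha> < \<beta>)"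

definition fundamental_sequence :: "'a::{wellorder,order_bot,no_top} \<Rightarrow> (nat \<Rightarrow> 'a) \<Rightarrow> bool" where
  "fundamental_sequence \<alpha> f \<longleftrightarrow>
     (if \<alpha> = \<bottom> then (\<forall>n. f n = \<bottom>)
      else mono f \<and> isLub UNIV (range (\<lambda>n. ord_suc (f n))) \<alpha>)"

text \<open>
  A system is given by \<open>F\<close>, where \<open>F \<alpha> n\<close> stands for \<open>\<alpha>[n]\<close>; only the values at
  \<open>\<alpha> \<le> \<Gamma>\<close> matter.
\<close>

definition fs_system :: "'a::{wellorder,order_bot,no_top} \<Rightarrow> ('a \<Rightarrow> nat \<Rightarrow> 'a) \<Rightarrow> bool" where
  "fs_system \<Gamma> F \<longleftrightarrow> (\<forall>\<alpha>\<le>\<Gamma>. fundamental_sequence \<alpha> (F \<alpha>))"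

definition nested :: "'a::{wellorder,order_bot,no_top} \<Rightarrow> ('a \<Rightarrow> nat \<Rightarrow> 'a) \<Rightarrow> bool" where
  "nested \<Gamma> F \<longleftrightarrow> (\<nexists>\<gamma> \<beta> n. \<gamma> < \<beta> \<and> \<beta> \<le> \<Gamma> \<and> n > 1 \<and> \<gamma> > F \<beta> n \<and> F \<beta> n > F \<gamma> n)"

text \<open>
  The identification of a finite set of natural numbers with its strictly increasing enumeration
  is \<^const>\<open>sorted_list_of_set\<close>; for infinite sets the enumeration is \<^const>\<open>enumerate\<close>.
\<close>

definition fs_iter :: "('a \<Rightarrow> nat \<Rightarrow> 'a) \<Rightarrow> 'a \<Rightarrow> nat set \<Rightarrow> 'a" where
  "fs_iter F \<alpha> s = foldl F \<alpha> (sorted_list_of_set s)"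

definition alpha_size :: "('a::{wellorder,order_bot,no_top} \<Rightarrow> nat \<Rightarrow> 'a) \<Rightarrow> 'a \<Rightarrow> nat set \<Rightarrow> bool" where
  "alpha_size F \<alpha> s \<longleftrightarrow>
     finite s \<and> fs_iter F \<alpha> s = \<bottom> \<and> (s \<noteq> {} \<longrightarrow> fs_iter F \<alpha> (s - {Max s}) > \<bottom>)"

definition size_family ::
    "('a::{wellorder,order_bot,no_top} \<Rightarrow> nat \<Rightarrow> 'a) \<Rightarrow> nat set \<Rightarrow> 'a \<Rightarrow> nat set set" where
  "size_family F M \<alpha> = {s. s \<subseteq> M \<and> alpha_size F \<alpha> s}"

definition proper_init_seg :: "nat set \<Rightarrow> nat set \<Rightarrow> bool" where
  "proper_init_seg s t \<longleftrightarrow> strict_prefix (sorted_list_of_set s) (sorted_list_of_set t)"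

definition init_seg_inf :: "nat set \<Rightarrow> nat set \<Rightarrow> bool" where
  "init_seg_inf s X \<longleftrightarrow> sorted_list_of_set s = map (enumerate X) [0..<card s]"

definition front :: "nat set set \<Rightarrow> bool" where
  "front B \<longleftrightarrow>
     B \<subseteq> Fpow UNIV \<and>
     (B = {{}} \<or>
      infinite (\<Union>B) \<and>
      (\<forall>X. infinite X \<and> X \<subseteq> \<Union>B \<longrightarrow> (\<exists>s\<in>B. init_seg_inf s X)) \<and>
      (\<nexists>s t. s \<in> B \<and> t \<in> B \<and> proper_init_seg s t))"

definition barrier :: "nat set set \<Rightarrow> bool" where
  "barrier B \<longleftrightarrow> front B \<and> (\<nexists>s t. s \<in> B \<and> t \<in> B \<and> s \<subset> t)"

definition smooth :: "nat set set \<Rightarrow> bool" where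
  "smooth B \<longleftrightarrow>
     (\<forall>s\<in>B. \<forall>t\<in>B. card s < card t \<longrightarrow>
        (\<exists>i<card s. sorted_list_of_set s ! i < sorted_list_of_set t ! i))"

end

theory Submission
  imports Defs
begin

text \<open>
  The front property holds because \<open>\<alpha>[x\<^sub>0][x\<^sub>1]\<dots>\<close> descends strictly until it reaches 0.
  For smoothness, call \<open>\<gamma> \<le> \<beta>\<close> an \<open>n\<close>-checkpoint below \<open>\<beta>\<close> if no step \<open>\<delta> \<mapsto> \<delta>[n]\<close> from an
  ordinal \<open>\<delta> \<in> (\<gamma>, \<beta>]\<close> jumps over \<open>\<gamma>\<close>.  In a nested system this relation between \<open>\<gamma>\<close> and \<open>\<beta>\<close>
  survives simultaneous steps \<open>\<gamma> \<mapsto> \<gamma>[t]\<close>, \<open>\<beta> \<mapsto> \<beta>[s]\<close> with \<open>n \<le> t \<le> s\<close>.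
  Hence \<open>t(i) \<le> s(i)\<close> for all \<open>i < |s|\<close> implies \<open>\<alpha>[t\<restriction>|s|] \<le> \<alpha>[s]\<close>, so an \<open>\<alpha>\<close>-size set \<open>t\<close>
  cannot be longer than \<open>s\<close>.  Smoothness rules out proper inclusions, as \<open>s \<subseteq> t\<close> forces \<open>t(i) \<le> s(i)\<close>.
\<close>

section \<open>Fundamental sequences and iterated descent\<close>

lemma less_ord_suc: "\<alpha> < ord_suc (\<alpha>::'a::{wellorder,no_top})"
  unfolding ord_suc_def using gt_ex[of \<alpha>] by (auto intro: LeastI)

lemma fs_system_bot [simp]: "fs_system \<Gamma> F \<Longrightarrow> F \<bottom> n = \<bottom>"
  by (auto simp: fs_system_def fundamental_sequence_def)

text \<open>Strictness comes from the successor in the definition: \<alpha> bounds every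
  \<open>ord_suc (F \<alpha> n)\<close>.\<close>

lemma fs_system_less:
  assumes "fs_system \<Gamma> F" "\<alpha> \<le> \<Gamma>" "\<alpha> \<noteq> \<bottom>"
  shows "F \<alpha> n < \<alpha>"
proof -
  have "isLub UNIV (range (\<lambda>n. ord_suc (F \<alpha> n))) \<alpha>"
    using assms by (auto simp: fs_system_def fundamental_sequence_def)
  then have "ord_suc (F \<alpha> n) \<le> \<alpha>"
    by (auto dest: isLubD2)
  then show ?thesis
    using less_ord_suc less_le_trans by blast
qed

lemma fs_system_le:
  assumes "fs_system \<Gamma> F" "\<alpha> \<le> \<Gamma>"
  shows "F \<alpha> n \<le> \<alpha>"
  using fs_system_less[OF assms, of n] assms(1) by (cases "\<alpha> = \<bottom>") auto

lemma fs_system_mono: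
  assumes "fs_system \<Gamma> F" "\<alpha> \<le> \<Gamma>" "m \<le> n"
  shows "F \<alpha> m \<le> F \<alpha> n"
proof (cases "\<alpha> = \<bottom>")
  case False
  then have "mono (F \<alpha>)"
    using assms by (auto simp: fs_system_def fundamental_sequence_def)
  then show ?thesis using assms(3) by (rule monoD)
qed (use assms in simp)

lemma foldl_bot: "fs_system \<Gamma> F \<Longrightarrow> foldl F \<bottom> xs = \<bottom>"
  by (induction xs) auto

lemma foldl_le:
  assumes "fs_system \<Gamma> F" "\<alpha> \<le> \<Gamma>"
  shows "foldl F \<alpha> xs \<le> \<Gamma>"
  using assms(2)
proof (induction xs arbitrary: \<alpha>)
  case (Cons x xs)
  then show ?case using fs_system_le[OF assms(1), of \<alpha> x] by (auto intro: order_trans)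
qed simp

text \<open>Otherwise every further argument would lower the value strictly, giving an infinite
  descending chain in a well-order.\<close>

lemma foldl_reaches_bot:
  assumes "fs_system \<Gamma> F" "\<alpha> \<le> \<Gamma>"
  shows "\<exists>k. foldl F \<alpha> (map x [0..<k]) = \<bottom>"
proof (rule ccontr)
  assume "\<not> ?thesis"
  then have "foldl F \<alpha> (map x [0..<Suc k]) < foldl F \<alpha> (map x [0..<k])" for k
    using fs_system_less[OF assms(1) foldl_le[OF assms]] by simp
  then have "\<exists>f :: nat \<Rightarrow> 'a. \<forall>i. (f (Suc i), f i) \<in> {(x, y). x < y}"
    by (intro exI[of _ "\<lambda>k. foldl F \<alpha> (map x [0..<k])"]) blast
  then show False
    using wf[where 'a = 'a] unfolding wf_iff_no_infinite_down_chain by blast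
qed

section \<open>The size condition in terms of sorted lists\<close>

lemma sorted_list_of_set_remove_Max:
  fixes s :: "'a::linorder set"
  assumes "finite s" "s \<noteq> {}"
  shows "sorted_list_of_set (s - {Max s}) = butlast (sorted_list_of_set s)"
proof -
  define l where "l = sorted_list_of_set s"
  have l: "sorted_wrt (<) l" "set l = s" "l \<noteq> []"
    using assms by (auto simp: l_def)
  have split: "l = butlast l @ [last l]" using l(3) by simp
  have less: "sorted_wrt (<) (butlast l)" "\<forall>x\<in>set (butlast l). x < last l"
    using l(1) by (subst (asm) split, simp add: sorted_wrt_append)+
  have set: "s = insert (last l) (set (butlast l))"
    using l(2) by (subst (asm) split, auto)
  have "Max s = last l"
    using less by (subst set, intro Max_eqI) auto
  then have "s - {Max s} = set (butlast l)"
    using set less by auto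
  then show ?thesis
    using less(1) by (simp add: l_def[symmetric] sorted_list_of_set.idem_if_sorted_distinct
        strict_sorted_iff)
qed

lemma alpha_size_iff:
  "alpha_size F \<alpha> s \<longleftrightarrow>
     finite s \<and> foldl F \<alpha> (sorted_list_of_set s) = \<bottom> \<and>
     (s \<noteq> {} \<longrightarrow> foldl F \<alpha> (butlast (sorted_list_of_set s)) \<noteq> \<bottom>)"
proof (cases "finite s \<and> s \<noteq> {}")
  case True
  then show ?thesis
    unfolding alpha_size_def fs_iter_def
    by (simp only: sorted_list_of_set_remove_Max bot.not_eq_extremum)
qed (auto simp: alpha_size_def fs_iter_def)

text \<open>Since \<open>\<bottom>\<close> is absorbing, reaching it on a proper prefix would mean
  reaching it before the maximum of \<open>t\<close> is read.\<close>

lemma foldl_proper_prefix_alpha_size: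
  assumes "fs_system \<Gamma> F" "alpha_size F \<alpha> t" "strict_prefix xs (sorted_list_of_set t)"
  shows "foldl F \<alpha> xs \<noteq> \<bottom>"
proof
  assume bot: "foldl F \<alpha> xs = \<bottom>"
  have "sorted_list_of_set t \<noteq> []" using assms(3) by auto
  then have t: "t \<noteq> {}" by auto
  have "prefix xs (butlast (sorted_list_of_set t))"
    using assms(3) prefix_snoc[of xs "butlast (sorted_list_of_set t)" "last (sorted_list_of_set t)"]
      \<open>sorted_list_of_set t \<noteq> []\<close> by (auto simp: strict_prefix_def)
  then have "foldl F \<alpha> (butlast (sorted_list_of_set t)) = \<bottom>"
    using bot foldl_bot[OF assms(1)] by (auto simp: prefix_def)
  then show False using assms(2) t by (auto simp: alpha_size_iff)
qed

section \<open>The front property\<close>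

lemma size_family_bot:
  assumes "fs_system \<Gamma> F"
  shows "size_family F M \<bottom> = {{}}"
  using foldl_bot[OF assms] by (auto simp: size_family_def alpha_size_iff)

lemma size_family_init_seg:
  assumes "fs_system \<Gamma> F" "\<alpha> \<le> \<Gamma>" "infinite X" "X \<subseteq> M"
  shows "\<exists>s\<in>size_family F M \<alpha>. init_seg_inf s X"
proof -
  \<comment> \<open>Stopping at the first zero makes the second clause of \<open>alpha_size\<close>
    hold, since the value one step earlier is nonzero.\<close>
  define k where "k = (LEAST k. foldl F \<alpha> (map (enumerate X) [0..<k]) = \<bottom>)"
  have k: "foldl F \<alpha> (map (enumerate X) [0..<k]) = \<bottom>"
    unfolding k_def using foldl_reaches_bot[OF assms(1,2)] by (rule LeastI_ex)
  have least: "foldl F \<alpha> (map (enumerate X) [0..<j]) \<noteq> \<bottom>" if "j < k" for j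
    using that not_less_Least unfolding k_def by blast
  define l where "l = map (enumerate X) [0..<k]"
  have "sorted_wrt (<) l"
    unfolding l_def sorted_wrt_map
    by (rule sorted_wrt_mono_rel[of _ "(<)"]) (use assms(3) in \<open>auto intro: enumerate_mono\<close>)
  then have l: "sorted_list_of_set (set l) = l" "card (set l) = k"
    by (simp_all only: strict_sorted_iff sorted_list_of_set.idem_if_sorted_distinct distinct_card)
      (simp add: l_def)
  have "butlast l = map (enumerate X) [0..<k - 1]"
    by (cases k) (auto simp: l_def)
  then have "alpha_size F \<alpha> (set l)"
    using k least[of "k - 1"] l(1) by (cases k) (auto simp: alpha_size_iff l_def)
  moreover have "set l \<subseteq> M"
    using assms(3,4) enumerate_in_set by (fastforce simp: l_def)
  moreover have "init_seg_inf (set l) X"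
    using l by (simp add: init_seg_inf_def l_def)
  ultimately show ?thesis by (auto simp: size_family_def)
qed

lemma Union_size_family:
  assumes "fs_system \<Gamma> F" "\<alpha> \<le> \<Gamma>" "\<alpha> \<noteq> \<bottom>" "infinite M"
  shows "\<Union>(size_family F M \<alpha>) = M"
proof
  show "\<Union>(size_family F M \<alpha>) \<subseteq> M" by (auto simp: size_family_def)
next
  show "M \<subseteq> \<Union>(size_family F M \<alpha>)"
  proof
    fix m assume m: "m \<in> M"
    \<comment> \<open>Now \<open>m\<close> is the minimum of \<open>X\<close>, so every nonempty
      initial segment of \<open>X\<close> contains it; \<open>s\<close> is nonempty because
      \<open>\<alpha> \<noteq> \<bottom>\<close>.\<close>
    define X where "X = M - {..<m}"
    have X: "infinite X" "X \<subseteq> M" using assms(4) by (auto simp: X_def)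
    obtain s where s: "s \<in> size_family F M \<alpha>" "init_seg_inf s X"
      using size_family_init_seg[OF assms(1,2) X] by blast
    have fin: "finite s" and "s \<noteq> {}"
      using s(1) assms(3) by (auto simp: size_family_def alpha_size_iff)
    then have "0 < card s" by (simp add: card_gt_0_iff)
    then have "enumerate X 0 \<in> set (sorted_list_of_set s)"
      using s(2) by (auto simp: init_seg_inf_def)
    moreover have "enumerate X 0 = m"
      unfolding enumerate_0 using m by (intro Least_equality) (auto simp: X_def)
    ultimately show "m \<in> \<Union>(size_family F M \<alpha>)" using s(1) fin by auto
  qed
qed

lemma front_size_family:
  assumes "fs_system \<Gamma> F" "\<alpha> \<le> \<Gamma>" "infinite M"
  shows "front (size_family F M \<alpha>)"
proof (cases "\<alpha> = \<bottom>")
  case True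
  then show ?thesis
    by (simp add: size_family_bot[OF assms(1)] front_def Fpow_def)
next
  case False
  have "size_family F M \<alpha> \<subseteq> Fpow UNIV"
    by (auto simp: size_family_def alpha_size_def Fpow_def)
  moreover have "\<not> proper_init_seg s t"
    if "s \<in> size_family F M \<alpha>" "t \<in> size_family F M \<alpha>" for s t
  proof
    assume "proper_init_seg s t"
    then have "foldl F \<alpha> (sorted_list_of_set s) \<noteq> \<bottom>"
      using foldl_proper_prefix_alpha_size[OF assms(1)] that(2)
      unfolding proper_init_seg_def size_family_def by blast
    then show False using that(1) by (simp add: size_family_def alpha_size_iff)
  qed
  ultimately show ?thesis
    unfolding front_def Union_size_family[OF assms(1,2) False assms(3)]
    using assms(3) size_family_init_seg[OF assms(1,2)] by simp
qed

section \<open>Checkpoints and smoothness\<close>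

definition checkpoint :: "('a::order \<Rightarrow> nat \<Rightarrow> 'a) \<Rightarrow> nat \<Rightarrow> 'a \<Rightarrow> 'a \<Rightarrow> bool" where
  "checkpoint F n \<gamma> \<beta> \<longleftrightarrow> \<gamma> \<le> \<beta> \<and> (\<forall>\<delta>. \<gamma> < \<delta> \<and> \<delta> \<le> \<beta> \<longrightarrow> \<gamma> \<le> F \<delta> n)"

lemma checkpoint_refl: "checkpoint F n \<alpha> \<alpha>"
  by (auto simp: checkpoint_def)

lemma nestedD:
  assumes "nested \<Gamma> F" "\<gamma> < \<beta>" "\<beta> \<le> \<Gamma>" "1 < n" "F \<beta> n < \<gamma>"
  shows "F \<beta> n \<le> F \<gamma> n"
  using assms unfolding nested_def by (meson not_le)

text \<open>An ordinal \<delta> in the new interval is compared with \<gamma>: below \<gamma>,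
  nestedness applies to \<delta> and \<gamma>; above \<gamma>, the old checkpoint stops the step at
  \<gamma> or higher.\<close>

lemma checkpoint_step:
  assumes "fs_system \<Gamma> F" "nested \<Gamma> F" "\<beta> \<le> \<Gamma>"
    and "checkpoint F n \<gamma> \<beta>" "n \<le> t" "t \<le> s" "1 < t"
  shows "checkpoint F t (F \<gamma> t) (F \<beta> s)"
proof -
  have le: "\<gamma> \<le> \<beta>" using assms(4) by (simp add: checkpoint_def)
  then have \<gamma>: "\<gamma> \<le> \<Gamma>" "F \<gamma> t \<le> \<gamma>"
    using assms(3) fs_system_le[OF assms(1)] by auto
  have \<beta>: "F \<beta> t \<le> F \<beta> s" "F \<beta> s \<le> \<beta>"
    using assms fs_system_mono fs_system_le by blast+
  \<comment> \<open>Raising the index from \<open>n\<close> to \<open>t\<close> only raises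
    \<open>F \<delta>\<close>, so \<gamma> is also a \<open>t\<close>-checkpoint.\<close>
  have cp: "\<gamma> \<le> F \<delta> t" if "\<gamma> < \<delta>" "\<delta> \<le> \<beta>" for \<delta>
    using that assms(3,4) fs_system_mono[OF assms(1) _ assms(5), of \<delta>]
    unfolding checkpoint_def by (meson order_trans)
  \<comment> \<open>If \<open>\<gamma> < \<beta>\<close>, the chain runs through \<gamma> and
    \<open>F \<beta> t\<close>; if they are equal, monotonicity in the index suffices.\<close>
  have "F \<gamma> t \<le> F \<beta> s"
    using cp[of \<beta>] le \<gamma>(2) \<beta>(1) by (cases "\<gamma> < \<beta>") (auto dest: order_trans)
  moreover have "F \<gamma> t \<le> F \<delta> t" if \<delta>: "F \<gamma> t < \<delta>" "\<delta> \<le> F \<beta> s" for \<delta>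
  proof (cases \<delta> \<gamma> rule: linorder_cases)
    case less
    then show ?thesis using nestedD[OF assms(2) less \<gamma>(1) assms(7) \<delta>(1)] by simp
  next
    case greater
    then have "\<gamma> \<le> F \<delta> t" using cp \<delta>(2) \<beta>(2) by auto
    then show ?thesis using \<gamma>(2) by simp
  qed simp
  ultimately show ?thesis by (simp add: checkpoint_def)
qed

text \<open>Each step replaces the index \<open>n\<close> by the entry \<open>t\<close> just read;
  sortedness of \<open>ts\<close> keeps the later entries at or above it.\<close>

lemma checkpoint_foldl_le:
  assumes "fs_system \<Gamma> F" "nested \<Gamma> F"
    and "list_all2 (\<le>) ts ss" "sorted ts" "\<forall>t\<in>set ts. 1 < t \<and> n \<le> t"
    and "\<beta> \<le> \<Gamma>" "checkpoint F n \<gamma> \<beta>"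
  shows "foldl F \<gamma> ts \<le> foldl F \<beta> ss"
  using assms(3-)
proof (induction arbitrary: n \<gamma> \<beta> rule: list_all2_induct)
  case Nil
  then show ?case by (simp add: checkpoint_def)
next
  case (Cons t ts s ss)
  have "checkpoint F t (F \<gamma> t) (F \<beta> s)"
    using Cons.prems Cons.hyps by (intro checkpoint_step[OF assms(1,2)]) auto
  moreover have "F \<beta> s \<le> \<Gamma>"
    using fs_system_le[OF assms(1) Cons.prems(3), of s] Cons.prems(3) by simp
  ultimately show ?case
    using Cons.IH[of t "F \<beta> s" "F \<gamma> t"] Cons.prems by auto
qed

lemma smooth_size_family:
  assumes "fs_system \<Gamma> F" "nested \<Gamma> F" "\<alpha> \<le> \<Gamma>" "\<forall>m\<in>M. 1 < m"
  shows "smooth (size_family F M \<alpha>)"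
  unfolding smooth_def
proof (intro ballI impI, rule ccontr)
  fix s t
  assume s: "s \<in> size_family F M \<alpha>" and t: "t \<in> size_family F M \<alpha>"
    and card: "card s < card t"
    and "\<not> (\<exists>i<card s. sorted_list_of_set s ! i < sorted_list_of_set t ! i)"
  then have le: "\<forall>i<card s. sorted_list_of_set t ! i \<le> sorted_list_of_set s ! i"
    by (meson not_less)
  define u where "u = take (card s) (sorted_list_of_set t)"
  have "list_all2 (\<le>) u (sorted_list_of_set s)"
    using card le by (auto simp: u_def list_all2_conv_all_nth)
  moreover have "sorted u" by (simp add: u_def sorted_wrt_take)
  \<comment> \<open>The conjunct \<open>0 \<le> x\<close> fixes the starting index as 0; \<alpha> is
    a checkpoint below itself for any index.\<close>
  moreover have "\<forall>x\<in>set u. 1 < x \<and> 0 \<le> x"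
    using t assms(4) by (auto simp: u_def size_family_def alpha_size_iff dest!: in_set_takeD)
  ultimately have "foldl F \<alpha> u \<le> foldl F \<alpha> (sorted_list_of_set s)"
    using checkpoint_foldl_le[OF assms(1,2)] assms(3) checkpoint_refl by blast
  then have "foldl F \<alpha> u = \<bottom>"
    using s by (simp add: size_family_def alpha_size_iff bot_unique)
  moreover have "strict_prefix u (sorted_list_of_set t)"
    using card by (auto simp: u_def strict_prefix_def take_is_prefix dest: arg_cong[of _ _ length])
  ultimately show False
    using foldl_proper_prefix_alpha_size[OF assms(1)] t by (auto simp: size_family_def)
qed

section \<open>From smoothness to barriers\<close>

text \<open>The entries of \<open>xs\<close> up to position \<open>i\<close> are
  \<open>i + 1\<close> members of \<open>ys\<close> that do not exceed
  \<open>xs ! i\<close>.\<close>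

lemma strict_sorted_subset_nth_le:
  fixes xs ys :: "'a::linorder list"
  assumes "sorted_wrt (<) xs" "sorted_wrt (<) ys" "set xs \<subseteq> set ys" "i < length xs"
  shows "ys ! i \<le> xs ! i"
proof -
  have len: "length xs \<le> length ys"
    using assms(1-3) by (metis List.finite_set card_mono distinct_card strict_sorted_iff)
  show ?thesis using assms(4)
  proof (induction i)
    case 0
    then obtain j where j: "j < length ys" "xs ! 0 = ys ! j"
      using assms(3) by (metis in_set_conv_nth subsetD)
    then show ?case
      using assms(2) by (auto simp: strict_sorted_iff sorted_nth_mono)
  next
    case (Suc i)
    obtain j where j: "j < length ys" "xs ! Suc i = ys ! j"
      using assms(3) Suc.prems by (metis in_set_conv_nth subsetD)
    have "ys ! i \<le> xs ! i" using Suc by simp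
    also have "\<dots> < ys ! j"
      using assms(1) Suc.prems j(2) by (metis lessI sorted_wrt_nth_less)
    \<comment> \<open>With \<open>j \<le> i\<close>, sortedness would give
      \<open>ys ! j \<le> ys ! i\<close>, against the strict chain. So \<open>j\<close> is at least
      \<open>Suc i\<close>.\<close>
    finally have "\<not> j \<le> i"
      using assms(2) Suc.prems len sorted_nth_mono[of ys j i] by (auto simp: strict_sorted_iff)
    then show ?case
      using assms(2) j by (auto simp: strict_sorted_iff intro: sorted_nth_mono)
  qed
qed

lemma smooth_front_imp_barrier:
  assumes "front B" "smooth B"
  shows "barrier B"
  unfolding barrier_def
proof (intro conjI notI)
  assume "\<exists>s t. s \<in> B \<and> t \<in> B \<and> s \<subset> t"
  then obtain s t where st: "s \<in> B" "t \<in> B" "s \<subset> t" by blast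
  have fin: "finite s" "finite t"
    using assms(1) st by (auto simp: front_def Fpow_def)
  have "card s < card t" using fin st(3) by (simp add: psubset_card_mono)
  then obtain i where "i < card s" and "sorted_list_of_set s ! i < sorted_list_of_set t ! i"
    using assms(2) st unfolding smooth_def by blast
  moreover have "sorted_list_of_set t ! i \<le> sorted_list_of_set s ! i" if "i < card s"
    using that fin st(3) by (intro strict_sorted_subset_nth_le) auto
  ultimately show False by simp
qed (fact assms(1))

theorem theorem3p1:
  fixes \<Gamma> :: "'a::{wellorder,order_bot,no_top}"
    and F :: "'a \<Rightarrow> nat \<Rightarrow> 'a"
    and M :: "nat set"
  assumes "fs_system \<Gamma> F"
    and "infinite M"
    and "Inf M > 1"
  shows "(\<forall>\<alpha>\<le>\<Gamma>. front (size_family F M \<alpha>)) \<and>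
         (nested \<Gamma> F \<longrightarrow> (\<forall>\<alpha>\<le>\<Gamma>. barrier (size_family F M \<alpha>) \<and> smooth (size_family F M \<alpha>)))"
proof -
  have "\<forall>m\<in>M. 1 < m"
    using assms(3) by (meson less_le_trans wellorder_Inf_le1)
  then show ?thesis
    using front_size_family[OF assms(1) _ assms(2)] smooth_size_family[OF assms(1)]
      smooth_front_imp_barrier by blast
qed

end
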